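(* Let $(X,d)$ be a nonempty G-complete metric space and let $T:X\to X$ be a mapping such that for all $x,y\in X$, $$x\neq y\ \Longrightarrow\ d(Tx,Ty)<d(x,y).$$ Then the following are equivalent: (i) $T$ has a unique fixed point $z\in X$, and moreover, for any $x\in X$, the sequence $\{T^nx\}$ converges to $z$. (ii) For any $x\in X$ and $\varepsilon>0$, there exists $\delta>0$ such that for all $i,j\in\mathbb{N}\cup\{0\}$, $d(T^ix,T^jx)<\varepsilon+\delta$ implies $d(T^{i+1}x,T^{j+1}x)\le\varepsilon$. (iii) For any $x\in X$ and $\varepsilon>0$, there exists $\delta>0$ such that for all $i\in\mathbb{N}\cup\{0\}$, $d(T^ix,T^{i+1}x)<\varepsilon+\delta$ implies $d(T^{i+1}x,T^{i+2}x)\le\varepsilon$.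
   Context: $\mathbb{N}=\{1,2,3,\dots\}$; $T^n$ is the $n$-fold iterate of $T$, with $T^0x=x$. A sequence $\{x_n\}$ in a metric space $(X,d)$ is called a G-Cauchy sequence if for every fixed $p\in\mathbb{N}$, $\lim_{n\to\infty}d(x_n,x_{n+p})=0$. A metric space is called G-complete if every G-Cauchy sequence in it converges (to a point of the space). *)

theory Defs
  imports "HOL-Analysis.Analysis"
begin

definition G_Cauchy :: "(nat \<Rightarrow> 'a::metric_space) \<Rightarrow> bool" where
  "G_Cauchy s \<longleftrightarrow> (\<forall>p\<ge>1. (\<lambda>n. dist (s n) (s (n + p))) \<longlonglongrightarrow> 0)"

text \<open>Stated for a subset, viewed as a metric space with the induced distance, in the style of
  the library's \<^const>\<open>complete\<close>.\<close>

definition G_complete :: "'a::metric_space set \<Rightarrow> bool" where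
  "G_complete X \<longleftrightarrow>
    (\<forall>s. (\<forall>n. s n \<in> X) \<and> G_Cauchy s \<longrightarrow> (\<exists>l\<in>X. s \<longlonglongrightarrow> l))"

end

theory Submission
  imports Defs
begin

text \<open>Contractivity alone makes the distances of consecutive iterates decrease; condition (iii)
  forbids a positive limit, so G-completeness yields a limit of each orbit, which is fixed by
  continuity. Conversely, if an orbit converges to \<open>z\<close>, a pair of indices that are both large never
  violates (ii), and for a small index \<open>i\<close> paired with a large \<open>j\<close> contractivity against \<open>z\<close>
  takes over from contractivity between orbit points. Only finitely many pairs remain.\<close>

text \<open>Since the gap \<open>p\<close> is fixed before \<open>n\<close> grows, the triangle
  inequality bounds the distance by a sum of \<open>p\<close> null sequences; induction on
  \<open>p\<close> adds them one at a time.\<close>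

lemma G_Cauchy_if_consecutive_tendsto_0:
  assumes "(\<lambda>n. dist (s n) (s (Suc n))) \<longlonglongrightarrow> 0"
  shows "G_Cauchy s"
proof -
  have "(\<lambda>n. dist (s n) (s (n + p))) \<longlonglongrightarrow> 0" for p
  proof (induction p)
    case (Suc p)
    have "(\<lambda>n. dist (s (n + p)) (s (Suc (n + p)))) \<longlonglongrightarrow> 0"
      using LIMSEQ_ignore_initial_segment[OF assms, of p] .
    then have "(\<lambda>n. dist (s n) (s (n + p)) + dist (s (n + p)) (s (Suc (n + p)))) \<longlonglongrightarrow> 0"
      using tendsto_add[OF Suc.IH] by simp
    then show ?case
      by (rule Lim_null_comparison[rotated]) (simp add: dist_triangle)
  qed simp
  then show ?thesis
    by (simp add: G_Cauchy_def)
qed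

text \<open>If the limit \<open>L\<close> were positive, \<open>jump\<close> at the level
  \<open>L\<close> itself would push the successor of some term down to at most \<open>L\<close>.
  That term is still positive, so \<open>strict\<close> takes the next one below \<open>L\<close>,
  which is a lower bound.\<close>

lemma tendsto_0_if_no_positive_limit:
  fixes d :: "nat \<Rightarrow> real"
  assumes nonneg: "\<And>n. 0 \<le> d n"
    and decr: "\<And>n. d (Suc n) \<le> d n"
    and strict: "\<And>n. 0 < d n \<Longrightarrow> d (Suc n) < d n"
    and jump: "\<And>\<epsilon>. 0 < \<epsilon> \<Longrightarrow> \<exists>\<delta>>0. \<forall>n. d n < \<epsilon> + \<delta> \<longrightarrow> d (Suc n) \<le> \<epsilon>"
  shows "d \<longlonglongrightarrow> 0"
proof -
  have dec: "decseq d"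
    using decr by (simp add: decseq_Suc_iff)
  obtain L where L: "d \<longlonglongrightarrow> L" and below: "\<And>n. L \<le> d n"
    using decseq_convergent[OF dec] nonneg by metis
  have "0 \<le> L"
    using L nonneg by (simp add: LIMSEQ_le_const)
  moreover have "\<not> 0 < L"
  proof
    assume "0 < L"
    then obtain \<delta> where "0 < \<delta>" and \<delta>: "\<And>n. d n < L + \<delta> \<Longrightarrow> d (Suc n) \<le> L"
      using jump by blast
    then have "\<forall>\<^sub>F n in sequentially. d n < L + \<delta>"
      using order_tendstoD(2)[OF L] by simp
    then obtain n where "d n < L + \<delta>"
      using eventually_happens'[OF sequentially_bot] by blast
    then have "d (Suc n) \<le> L"
      by (rule \<delta>)
    moreover have "d (Suc (Suc n)) < d (Suc n)"
      using strict below[of "Suc n"] \<open>0 < L\<close> by force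
    ultimately show False
      using below[of "Suc (Suc n)"] by linarith
  qed
  ultimately show ?thesis
    using L by simp
qed

text \<open>Either the conclusion already holds, or \<open>a\<close> exceeds \<epsilon> and every
  \<delta> below the gap makes the premise fail. Phrasing this with \<open>at_right 0\<close> lets
  finitely many such constraints be combined without explicit minima.\<close>

lemma eventually_at_right_0_jump:
  fixes a b \<epsilon> :: real
  assumes "b < a \<or> b \<le> \<epsilon>"
  shows "\<forall>\<^sub>F \<delta> in at_right 0. a < \<epsilon> + \<delta> \<longrightarrow> b \<le> \<epsilon>"
proof (cases "a \<le> \<epsilon>")
  case True
  then show ?thesis
    using assms by (intro always_eventually) auto
next
  case False
  then have "\<forall>\<^sub>F \<delta> in at_right 0. \<delta> \<in> {0<..<a - \<epsilon>}"
    by (intro eventually_at_right_real) simp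
  then show ?thesis
    by eventually_elim auto
qed

text \<open>This is (ii) for one orbit. The map is absent: \<open>fixed\<close> and
  \<open>fixed_lim\<close> keep what is needed of \<open>s\<close> being an orbit of a map that
  fixes \<open>z\<close>.\<close>

lemma convergent_orbit_jump:
  fixes s :: "nat \<Rightarrow> 'a::metric_space"
  assumes lim: "s \<longlonglongrightarrow> z"
    and contr: "\<And>i j. s i \<noteq> s j \<Longrightarrow> dist (s (Suc i)) (s (Suc j)) < dist (s i) (s j)"
    and contr_lim: "\<And>i. s i \<noteq> z \<Longrightarrow> dist (s (Suc i)) z < dist (s i) z"
    and fixed: "\<And>i j. s i = s j \<Longrightarrow> s (Suc i) = s (Suc j)"
    and fixed_lim: "\<And>i. s i = z \<Longrightarrow> s (Suc i) = z"
    and \<epsilon>: "0 < \<epsilon>"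
  shows "\<exists>\<delta>>0. \<forall>i j. dist (s i) (s j) < \<epsilon> + \<delta> \<longrightarrow> dist (s (Suc i)) (s (Suc j)) \<le> \<epsilon>"
proof -
  define P where
    "P \<delta> i j \<longleftrightarrow> (dist (s i) (s j) < \<epsilon> + \<delta> \<longrightarrow> dist (s (Suc i)) (s (Suc j)) \<le> \<epsilon>)" for \<delta> i j
  have pair: "\<forall>\<^sub>F \<delta> in at_right 0. P \<delta> i j" for i j
    unfolding P_def using contr[of i j] fixed[of i j] \<epsilon>
    by (intro eventually_at_right_0_jump) (cases "s i = s j"; auto)
  have lim_dist: "(\<lambda>j. dist (s i) (s j)) \<longlonglongrightarrow> dist (s i) z" for i
    by (intro tendsto_intros lim)
  have lim_dist_Suc: "(\<lambda>j. dist (s i) (s (Suc j))) \<longlonglongrightarrow> dist (s i) z" for i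
    using lim_dist LIMSEQ_Suc by blast
  \<comment> \<open>For fixed \<open>i\<close>, infinitely many \<open>j\<close> must share one
    \<delta>. For large \<open>j\<close>, \<open>z\<close> replaces \<open>s j\<close> and
    \<open>s (Suc j)\<close>: either the conclusion of \<open>P\<close> holds for any \<delta>, or
    its premise fails for small \<delta>.\<close>
  have row: "\<forall>\<^sub>F \<delta> in at_right 0. \<forall>j. P \<delta> i j" for i
  proof -
    have "\<exists>N. \<forall>\<^sub>F \<delta> in at_right 0. \<forall>j\<ge>N. P \<delta> i j"
    proof (cases "dist (s (Suc i)) z < \<epsilon>")
      case True
      then obtain N where "\<And>j. j \<ge> N \<Longrightarrow> dist (s (Suc i)) (s (Suc j)) < \<epsilon>"
        using order_tendstoD(2)[OF lim_dist_Suc] by (meson eventually_sequentially)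
      then have "\<forall>\<delta>. \<forall>j\<ge>N. P \<delta> i j"
        by (simp add: P_def less_imp_le)
      then show ?thesis
        by (blast intro: always_eventually)
    next
      case False
      \<comment> \<open>Strictness in \<open>contr_lim\<close> is essential here: it leaves room for
        a level \<open>c\<close> above \<epsilon> that the distances from \<open>s i\<close> to
        \<open>s j\<close> eventually exceed.\<close>
      then have far: "\<epsilon> < dist (s i) z"
        using contr_lim[of i] fixed_lim[of i] \<epsilon> by (cases "s i = z") auto
      then obtain c where "\<epsilon> < c" "c < dist (s i) z"
        using dense by blast
      then obtain N where N: "\<And>j. j \<ge> N \<Longrightarrow> c < dist (s i) (s j)"
        using order_tendstoD(1)[OF lim_dist] by (meson eventually_sequentially)
      have "\<forall>\<^sub>F \<delta> in at_right 0. \<delta> \<in> {0<..<c - \<epsilon>}"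
        using \<open>\<epsilon> < c\<close> by (intro eventually_at_right_real) simp
      then have "\<forall>\<^sub>F \<delta> in at_right 0. \<forall>j\<ge>N. P \<delta> i j"
        by eventually_elim (use N in \<open>force simp: P_def\<close>)
      then show ?thesis ..
    qed
    then obtain N where "\<forall>\<^sub>F \<delta> in at_right 0. \<forall>j\<ge>N. P \<delta> i j" ..
    moreover have "\<forall>\<^sub>F \<delta> in at_right 0. \<forall>j\<in>{..<N}. P \<delta> i j"
      by (intro eventually_ball_finite ballI pair) simp
    ultimately show ?thesis
      by eventually_elim (metis lessThan_iff not_less)
  qed
  have "\<forall>\<^sub>F n in sequentially. dist (s n) z < \<epsilon> / 2"
    using \<epsilon> by (intro tendstoD[OF lim]) simp
  then obtain N where N: "\<And>n. n \<ge> N \<Longrightarrow> dist (s n) z < \<epsilon> / 2"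
    by (auto simp: eventually_sequentially)
  \<comment> \<open>Both successors lie within half of \<epsilon> of \<open>z\<close>, so \<delta>
    is unrestricted.\<close>
  have tail: "P \<delta> i j" if "i \<ge> N" "j \<ge> N" for \<delta> i j
  proof -
    have "dist (s (Suc i)) (s (Suc j)) < \<epsilon>"
      using that by (intro dist_triangle_half_l[OF N N]) auto
    then show ?thesis
      by (simp add: P_def)
  qed
  have sym: "P \<delta> i j \<longleftrightarrow> P \<delta> j i" for \<delta> i j
    by (simp add: P_def dist_commute)
  have "\<forall>\<^sub>F \<delta> in at_right 0. \<forall>i\<in>{..<N}. \<forall>j. P \<delta> i j"
    by (intro eventually_ball_finite ballI row) simp
  \<comment> \<open>Only the finitely many rows \<open>i < N\<close> constrain \<delta>:
    \<open>sym\<close> moves a small second index to the front, and \<open>tail\<close> covers the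
    rest.\<close>
  then have "\<forall>\<^sub>F \<delta> in at_right (0::real). 0 < \<delta> \<and> (\<forall>i j. P \<delta> i j)"
    using eventually_at_right_less[of 0]
    by eventually_elim (metis lessThan_iff not_less sym tail)
  then obtain \<delta> where "0 < \<delta>" "\<forall>i j. P \<delta> i j"
    using eventually_happens'[OF trivial_limit_at_right_real] by blast
  then show ?thesis
    by (auto simp: P_def)
qed

theorem theorem5p1:
  fixes X :: "'a::metric_space set" and T :: "'a \<Rightarrow> 'a"
  assumes "X \<noteq> {}"
    and "G_complete X"
    and "T \<in> X \<rightarrow> X"
    and "\<And>x y. x \<in> X \<Longrightarrow> y \<in> X \<Longrightarrow> x \<noteq> y \<Longrightarrow> dist (T x) (T y) < dist x y"
  shows
    "((\<exists>z\<in>X. T z = z \<and> (\<forall>w\<in>X. T w = w \<longrightarrow> w = z) \<and>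
          (\<forall>x\<in>X. (\<lambda>n. (T ^^ n) x) \<longlonglongrightarrow> z))
      \<longleftrightarrow>
      (\<forall>x\<in>X. \<forall>\<epsilon>>0. \<exists>\<delta>>0. \<forall>i j.
          dist ((T ^^ i) x) ((T ^^ j) x) < \<epsilon> + \<delta> \<longrightarrow>
          dist ((T ^^ (i + 1)) x) ((T ^^ (j + 1)) x) \<le> \<epsilon>))
     \<and>
     ((\<forall>x\<in>X. \<forall>\<epsilon>>0. \<exists>\<delta>>0. \<forall>i j.
          dist ((T ^^ i) x) ((T ^^ j) x) < \<epsilon> + \<delta> \<longrightarrow>
          dist ((T ^^ (i + 1)) x) ((T ^^ (j + 1)) x) \<le> \<epsilon>)
      \<longleftrightarrow>
      (\<forall>x\<in>X. \<forall>\<epsilon>>0. \<exists>\<delta>>0. \<forall>i.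
          dist ((T ^^ i) x) ((T ^^ (i + 1)) x) < \<epsilon> + \<delta> \<longrightarrow>
          dist ((T ^^ (i + 1)) x) ((T ^^ (i + 2)) x) \<le> \<epsilon>))"
  (is "(?i \<longleftrightarrow> ?ii) \<and> (_ \<longleftrightarrow> ?iii)")
proof -
  note contr = assms(4)
  have T: "T x \<in> X" if "x \<in> X" for x
    using assms(3) that by blast
  have orbit: "(T ^^ n) x \<in> X" if "x \<in> X" for n x
    using that by (induction n) (auto intro: T)
  have nonexp: "dist (T x) (T y) \<le> dist x y" if "x \<in> X" "y \<in> X" for x y
    using contr[OF that] by (cases "x = y") auto
  have "?ii" if ?i
  proof (intro ballI allI impI)
    fix x and \<epsilon> :: real
    assume x: "x \<in> X" and \<epsilon>: "0 < \<epsilon>"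
    from \<open>?i\<close> obtain z where z: "z \<in> X" "T z = z" and lim: "(\<lambda>n. (T ^^ n) x) \<longlonglongrightarrow> z"
      using x by blast
    show "\<exists>\<delta>>0. \<forall>i j. dist ((T ^^ i) x) ((T ^^ j) x) < \<epsilon> + \<delta> \<longrightarrow>
        dist ((T ^^ (i + 1)) x) ((T ^^ (j + 1)) x) \<le> \<epsilon>"
      using convergent_orbit_jump[OF lim _ _ _ _ \<epsilon>] contr[OF orbit[OF x] orbit[OF x]]
        contr[OF orbit[OF x] z(1)] z(2)
      by simp
  qed
  moreover have "?iii" if ?ii
  proof (intro ballI allI impI)
    fix x and \<epsilon> :: real
    assume "x \<in> X" "0 < \<epsilon>"
    with \<open>?ii\<close> obtain \<delta> where "0 < \<delta>" and
      \<delta>: "\<And>i j. dist ((T ^^ i) x) ((T ^^ j) x) < \<epsilon> + \<delta> \<Longrightarrow>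
        dist ((T ^^ (i + 1)) x) ((T ^^ (j + 1)) x) \<le> \<epsilon>"
      by meson
    then show "\<exists>\<delta>>0. \<forall>i. dist ((T ^^ i) x) ((T ^^ (i + 1)) x) < \<epsilon> + \<delta> \<longrightarrow>
        dist ((T ^^ (i + 1)) x) ((T ^^ (i + 2)) x) \<le> \<epsilon>"
      using \<delta>[of i "i + 1" for i] by (intro exI[of _ \<delta>]) simp
  qed
  moreover have "?i" if ?iii
  proof -
    have unique: "v = w" if "v \<in> X" "w \<in> X" "T v = v" "T w = w" for v w
      using contr[OF that(1,2)] that(3,4) by fastforce
    have lim: "\<exists>z\<in>X. T z = z \<and> (\<lambda>n. (T ^^ n) x) \<longlonglongrightarrow> z" if x: "x \<in> X" for x
    proof -
      let ?s = "\<lambda>n. (T ^^ n) x"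
      have "(\<lambda>n. dist (?s n) (?s (Suc n))) \<longlonglongrightarrow> 0"
      proof (rule tendsto_0_if_no_positive_limit)
        show "dist (?s (Suc n)) (?s (Suc (Suc n))) \<le> dist (?s n) (?s (Suc n))" for n
          using nonexp[OF orbit[OF x] orbit[OF x], of n "Suc n"] by simp
        show "dist (?s (Suc n)) (?s (Suc (Suc n))) < dist (?s n) (?s (Suc n))"
          if "0 < dist (?s n) (?s (Suc n))" for n
          using contr[OF orbit[OF x] orbit[OF x], of n "Suc n"] that by simp
        show "\<exists>\<delta>>0. \<forall>n. dist (?s n) (?s (Suc n)) < \<epsilon> + \<delta> \<longrightarrow>
            dist (?s (Suc n)) (?s (Suc (Suc n))) \<le> \<epsilon>" if "0 < \<epsilon>" for \<epsilon>
          using \<open>?iii\<close> x that by simp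
      qed simp
      then have "G_Cauchy ?s"
        by (rule G_Cauchy_if_consecutive_tendsto_0)
      moreover have "\<forall>n. ?s n \<in> X"
        using orbit[OF x] by simp
      ultimately obtain z where z: "z \<in> X" and lim: "?s \<longlonglongrightarrow> z"
        using assms(2)[unfolded G_complete_def, rule_format, of ?s] by auto
      have "(\<lambda>n. dist (?s n) z) \<longlonglongrightarrow> 0"
        using lim by (rule tendsto_dist_iff[THEN iffD1])
      \<comment> \<open>Continuity of \<open>T\<close> at \<open>z\<close> enters through
        \<open>nonexp\<close>, so the shifted orbit tends to \<open>T z\<close> as well as to
        \<open>z\<close>.\<close>
      then have "(\<lambda>n. dist (?s (Suc n)) (T z)) \<longlonglongrightarrow> 0"
        by (rule Lim_null_comparison[rotated]) (simp add: nonexp orbit x z)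
      then have "(\<lambda>n. ?s (Suc n)) \<longlonglongrightarrow> T z"
        by (rule tendsto_dist_iff[THEN iffD2])
      then have "T z = z"
        by (rule LIMSEQ_unique) (rule LIMSEQ_Suc[OF lim])
      with z lim show ?thesis
        by blast
    qed
    obtain x where "x \<in> X"
      using assms(1) by blast
    then obtain z where z: "z \<in> X" "T z = z"
      using lim by blast
    \<comment> \<open>Each orbit has its own limit, but all these limits are fixed points and hence
      coincide.\<close>
    have "(\<lambda>n. (T ^^ n) y) \<longlonglongrightarrow> z" if "y \<in> X" for y
      using lim[OF that] unique[OF z(1) _ z(2)] by force
    with z unique show ?thesis
      by (intro bexI[of _ z]) auto
  qed
  ultimately show ?thesis
    by argo
qed

end
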